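(* For every integer $n\ge 0$, the chromatic polynomial of the matroid $\mathcal M_n$ is $$p_{\mathcal M_n}(t)=(t-1)^n.$$
   Context: $[n]$ denotes the linearly ordered set $\{0<1<\dots<n\}$, with meet $i\wedge j=\min(i,j)$. $[n]^\to$ denotes the set of nontrivial edges of $[n]$, i.e. pairs $(i\to j)$ with $0\le i<j\le n$. A transfer system on $[n]$ is a partial order $T$ on the set $[n]$ that is contained in $\le$ (reflexive, transitive, and $i\,T\,j$ implies $i\le j$) and is closed under restriction: if $i\,T\,j$ and $k\in[n]$, then $(i\wedge k)\,T\,(j\wedge k)$. For every $S\subseteq[n]^\to$ there is a smallest transfer system containing $S$, called the transfer system generated by $S$. A set $S\subseteq [n]^\to$ is a minimal generating set if no proper subset of $S$ generates the same transfer system as $S$; $\mathrm{MGS}([n])\subseteq\mathcal P([n]^\to)$ denotes the collection of all minimal generating sets (of all transfer systems on $[n]$). $\mathcal M_n=([n]^\to,\mathrm{MGS}([n]))$ is the matroid with ground set $[n]^\to$ whose independent sets are the elements of $\mathrm{MGS}([n])$ (it is a fact that this pair is a matroid). For a matroid $(E,I)$ with ground set $E$ and collection of independent sets $I$, the rank $r(S)$ of $S\subseteq E$ is the size of a largest independent subset of $S$, and the chromatic polynomial is $$p_E(t)=\sum_{S\subseteq E}(-1)^{|S|}t^{r(E)-r(S)}.$$ *)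

theory Defs
  imports "HOL-Computational_Algebra.Polynomial"
begin

text \<open>The ordered set \<open>[n] = {0 < 1 < \<dots> < n}\<close> is represented by \<open>{0..n} :: nat set\<close>,
  with \<open>min\<close> as meet.\<close>

definition edges :: "nat \<Rightarrow> (nat \<times> nat) set" where
  "edges n = {(i, j). i < j \<and> j \<le> n}"

definition transfer_system :: "nat \<Rightarrow> (nat \<times> nat) set \<Rightarrow> bool" where
  "transfer_system n T \<longleftrightarrow>
     partial_order_on {0..n} T \<and>
     (\<forall>(i, j)\<in>T. i \<le> j) \<and>
     (\<forall>(i, j)\<in>T. \<forall>k\<in>{0..n}. (min i k, min j k) \<in> T)"

definition generated :: "nat \<Rightarrow> (nat \<times> nat) set \<Rightarrow> (nat \<times> nat) set" where
  "generated n S = \<Inter>{T. transfer_system n T \<and> S \<subseteq> T}"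

definition MGS :: "nat \<Rightarrow> (nat \<times> nat) set set" where
  "MGS n = {S. S \<subseteq> edges n \<and> (\<forall>S'. S' \<subset> S \<longrightarrow> generated n S' \<noteq> generated n S)}"

text \<open>The intersection defining \<^const>\<open>generated\<close> is over a nonempty family and is the smallest
  transfer system containing \<open>S\<close>.\<close>

lemma transfer_system_le: "transfer_system n {(i, j). i \<le> j \<and> j \<le> n}"
  by (auto simp: transfer_system_def partial_order_on_def preorder_on_def refl_on_def
      trans_def antisym_def min_def)

lemma transfer_system_generated:
  assumes "S \<subseteq> edges n"
  shows "transfer_system n (generated n S)"
proof -
  let ?F = "{T. transfer_system n T \<and> S \<subseteq> T}"
  let ?L = "{(i, j). i \<le> j \<and> j \<le> n}"
  have L: "?L \<in> ?F"
    using assms transfer_system_le by (auto simp: edges_def)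
  have sub: "generated n S \<subseteq> ?L"
    unfolding generated_def using L by blast
  have "refl_on {0..n} (generated n S)"
    by (auto simp: generated_def transfer_system_def partial_order_on_def preorder_on_def refl_on_def)
  moreover have "trans (generated n S)"
    unfolding generated_def
    by (rule trans_INTER[where r = id, simplified])
      (auto simp: transfer_system_def partial_order_on_def preorder_on_def)
  moreover have "antisym (generated n S)"
    by (rule antisym_subset[OF sub]) (auto simp: antisym_def)
  moreover have "\<forall>(i, j)\<in>generated n S. \<forall>k\<in>{0..n}. (min i k, min j k) \<in> generated n S"
    unfolding generated_def transfer_system_def by blast
  ultimately show ?thesis
    using sub
    by (auto simp: transfer_system_def partial_order_on_def preorder_on_def)
qed

lemma subset_generated: "S \<subseteq> generated n S"
  by (auto simp: generated_def)

lemma generated_least: "transfer_system n T \<Longrightarrow> S \<subseteq> T \<Longrightarrow> generated n S \<subseteq> T"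
  by (auto simp: generated_def)

text \<open>A (finite) matroid is given by the pair of its ground set and its collection of independent
  sets; rank and chromatic polynomial are defined for any such pair.\<close>

definition rank :: "'a set \<times> 'a set set \<Rightarrow> 'a set \<Rightarrow> nat" where
  "rank M S = Max {card X | X. X \<subseteq> S \<and> X \<in> snd M}"

text \<open>The subtraction in the exponent does not truncate: for a finite ground set with the empty set
  independent, \<^const>\<open>rank\<close> is monotone.\<close>

definition chromatic_poly :: "'a set \<times> 'a set set \<Rightarrow> int poly" where
  "chromatic_poly M =
     (\<Sum>S\<in>Pow (fst M). monom ((-1) ^ card S) (rank M (fst M) - rank M S))"

definition transfer_matroid :: "nat \<Rightarrow> (nat \<times> nat) set \<times> (nat \<times> nat) set set" where
  "transfer_matroid n = (edges n, MGS n)"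

end

theory Submission
  imports Defs
begin

text \<open>A restriction of an edge keeps its source, so a minimal generating set cannot contain two edges
  with the same source; and the edges with source \<open>i\<close> can only be generated by edges with source
  \<open>i\<close>. Hence the matroid is the partition matroid of the ground set partitioned by sources, and the
  chromatic polynomial factors over the \<open>n\<close> nonempty blocks, each of which contributes
  \<open>t - 1\<close>: the empty set gives \<open>t\<close>, the nonempty sets give \<open>-1\<close> in total.\<close>

lemma edges_eq_Sigma: "edges n = (SIGMA i:{..<n}. {i<..n})"
  by (auto simp: edges_def)

lemma finite_edges: "finite (edges n)"
  by (simp add: edges_eq_Sigma)

lemma generated_mono: "S \<subseteq> T \<Longrightarrow> generated n S \<subseteq> generated n T"
  by (auto simp: generated_def)

text \<open>Restricting \<open>(i, k)\<close> by \<open>j\<close> fixes the source \<open>i\<close>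
  and cuts the target down to \<open>j\<close>.\<close>

lemma generated_restrict:
  assumes "S \<subseteq> edges n" "(i, k) \<in> generated n S" "i < j" "j \<le> k"
  shows "(i, j) \<in> generated n S"
proof -
  have T: "transfer_system n (generated n S)"
    by (rule transfer_system_generated[OF assms(1)])
  \<comment> \<open>Comparison with the full order bounds \<open>k\<close>, hence \<open>j\<close>,
    by \<open>n\<close>, so restriction by \<open>j\<close> is allowed.\<close>
  have "generated n S \<subseteq> {(i, j). i \<le> j \<and> j \<le> n}"
    using assms(1) by (intro generated_least transfer_system_le) (auto simp: edges_def)
  with assms have "j \<in> {0..n}" by auto
  with T assms(2) have "(min i j, min k j) \<in> generated n S"
    unfolding transfer_system_def by blast
  with assms(3,4) show ?thesis by (simp add: min_def split: if_splits)
qed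

lemma generated_source:
  assumes "S \<subseteq> edges n" "(i, j) \<in> generated n S" "i < j"
  shows "i \<in> fst ` S"
proof (rule ccontr)
  assume i: "i \<notin> fst ` S"
  \<comment> \<open>The full order without its nontrivial edges out of \<open>i\<close>. It is
    closed under restriction: if a source \<open>a \<noteq> i\<close> is cut down to
    \<open>i\<close>, then \<open>a > i\<close>, so the target is cut down to \<open>i\<close> as
    well.\<close>
  let ?T = "{(a, b). a \<le> b \<and> b \<le> n \<and> (a = i \<longrightarrow> b = i)}"
  have "transfer_system n ?T"
    by (auto simp: transfer_system_def partial_order_on_def preorder_on_def refl_on_def
        trans_def antisym_def min_def split: if_splits)
  moreover have "S \<subseteq> ?T"
    using assms(1) i by (force simp: edges_def)
  ultimately have "generated n S \<subseteq> ?T"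
    by (rule generated_least)
  with assms(2,3) show False by auto
qed

lemma MGS_iff: "S \<in> MGS n \<longleftrightarrow> S \<subseteq> edges n \<and> inj_on fst S"
proof (intro iffI conjI)
  assume S: "S \<in> MGS n"
  then show sub: "S \<subseteq> edges n" by (simp add: MGS_def)
  have False if jk: "(i, j) \<in> S" "(i, k) \<in> S" "j < k" for i j k
  proof -
    \<comment> \<open>The shorter edge is the one to drop, since it is a restriction of the longer
      one, which stays.\<close>
    let ?S' = "S - {(i, j)}"
    have "i < j" using jk sub by (auto simp: edges_def)
    have "(i, k) \<in> generated n ?S'"
      using jk subset_generated[of ?S' n] by auto
    then have "(i, j) \<in> generated n ?S'"
      using sub \<open>i < j\<close> jk by (intro generated_restrict[of ?S' n i k j]) auto
    then have "S \<subseteq> generated n ?S'"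
      using subset_generated[of ?S' n] by blast
    moreover have "transfer_system n (generated n ?S')"
      using sub by (intro transfer_system_generated) auto
    ultimately have "generated n S \<subseteq> generated n ?S'"
      by (intro generated_least)
    moreover have "generated n ?S' \<subseteq> generated n S"
      by (rule generated_mono) auto
    moreover have "?S' \<subset> S" using jk by auto
    ultimately show False using S by (auto simp: MGS_def)
  qed
  then show "inj_on fst S"
    by (auto simp: inj_on_def) (metis linorder_less_linear)
next
  assume S: "S \<subseteq> edges n \<and> inj_on fst S"
  have "generated n S' \<noteq> generated n S" if "S' \<subset> S" for S'
  proof
    assume eq: "generated n S' = generated n S"
    \<comment> \<open>To generate the missing edge, \<open>S'\<close> must still contain an edge
      with source \<open>i\<close>. That edge differs from \<open>(i, j)\<close>, against
      injectivity of \<open>fst\<close> on \<open>S\<close>.\<close>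
    from that obtain i j where ij: "(i, j) \<in> S" "(i, j) \<notin> S'" by auto
    then have "(i, j) \<in> generated n S'" "i < j"
      using S subset_generated[of S n] eq by (auto simp: edges_def)
    then have "i \<in> fst ` S'"
      using S that by (intro generated_source[of S' n i j]) auto
    then obtain k where "(i, k) \<in> S'" by auto
    with ij S that show False by (auto dest: inj_onD[of fst S "(i, j)" "(i, k)"])
  qed
  with S show "S \<in> MGS n" by (auto simp: MGS_def)
qed

lemma rank_transfer_matroid:
  assumes "S \<subseteq> edges n"
  shows "rank (transfer_matroid n) S = card (fst ` S)"
proof -
  have fin: "finite S"
    using assms finite_edges finite_subset by blast
  show ?thesis
    unfolding rank_def transfer_matroid_def
  proof (rule Max_eqI)
    show "finite {card X |X. X \<subseteq> S \<and> X \<in> snd (edges n, MGS n)}"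
      using fin by simp
  next
    fix y assume "y \<in> {card X |X. X \<subseteq> S \<and> X \<in> snd (edges n, MGS n)}"
    then obtain X where X: "y = card X" "X \<subseteq> S" "inj_on fst X"
      by (auto simp: MGS_iff)
    then have "y = card (fst ` X)" by (simp add: card_image)
    also have "\<dots> \<le> card (fst ` S)"
      using fin X by (intro card_mono image_mono) auto
    finally show "y \<le> card (fst ` S)" .
  next
    \<comment> \<open>The bound is attained by picking one edge of \<open>S\<close> for each source
      that occurs.\<close>
    obtain X where "X \<subseteq> S" "inj_on fst X" "fst ` S = fst ` X"
      using subset_image_inj[of "fst ` S" fst S] by auto
    then show "card (fst ` S) \<in> {card X |X. X \<subseteq> S \<and> X \<in> snd (edges n, MGS n)}"
      using assms by (auto simp: MGS_iff card_image intro!: exI[of _ X])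
  qed
qed

text \<open>Expand the product of \<open>-1 + 1\<close> over \<open>A\<close>, taking
  \<open>-1\<close> on \<open>X\<close> and \<open>1\<close> off it; a nonempty \<open>A\<close>
  makes the product vanish.\<close>

lemma sum_Pow_minus_one_power_card:
  assumes "finite A" "A \<noteq> {}"
  shows "(\<Sum>X\<in>Pow A. (-1) ^ card X) = (0 :: 'a :: comm_ring_1)"
  using assms prod_add[of A "\<lambda>_. -1 :: 'a" "\<lambda>_. 1"] by (simp add: zero_power card_gt_0_iff)

text \<open>The exponent is the corank of \<open>X\<close> within a single block, where every
  nonempty set has rank 1.\<close>

lemma sum_Pow_block:
  assumes "finite A" "A \<noteq> {}"
  shows "(\<Sum>X\<in>Pow A. monom ((-1) ^ card X) (if X = {} then 1 else 0))
    = ([:-1, 1:] :: 'a :: comm_ring_1 poly)"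
proof -
  have "(\<Sum>X\<in>Pow A - {{}}. (-1) ^ card X) = (-1 :: 'a)"
    using sum_Pow_minus_one_power_card[OF assms, where 'a = 'a] assms
    by (simp add: sum.remove[of "Pow A" "{}"] add_eq_0_iff)
  then have "(\<Sum>X\<in>Pow A - {{}}. monom ((-1) ^ card X) (if X = {} then 1 else 0))
      = [:-1 :: 'a:]"
    by (simp add: monom_sum[symmetric] monom_0[symmetric] cong: sum.cong_simp)
  then show ?thesis
    using assms by (subst sum.remove[of _ "{}"]) (simp_all add: monom_altdef)
qed

text \<open>Induction on the set of blocks: both the sign and the corank split along a new block, so
  each block multiplies the sum by the factor of \<open>sum_Pow_block\<close>.\<close>

lemma sum_Pow_Sigma:
  assumes "finite A" "\<And>i. i \<in> A \<Longrightarrow> finite (B i)" "\<And>i. i \<in> A \<Longrightarrow> B i \<noteq> {}"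
  shows "(\<Sum>S\<in>Pow (Sigma A B). monom ((-1) ^ card S) (card A - card (fst ` S)))
    = ([:-1, 1:] :: 'a :: comm_ring_1 poly) ^ card A"
  using assms
proof (induction A rule: finite_induct)
  case empty
  then show ?case by (simp add: monom_altdef)
next
  case (insert a A)
  define w :: "'b set \<Rightarrow> ('b \<times> 'c) set \<Rightarrow> 'a poly"
    where "w A S = monom ((-1) ^ card S) (card A - card (fst ` S))" for A S
  define u :: "'c set \<Rightarrow> 'a poly"
    where "u X = monom ((-1) ^ card X) (if X = {} then 1 else 0)" for X
  let ?f = "\<lambda>(X, S). {a} \<times> X \<union> S"
  \<comment> \<open>A subset is determined by its fibre over \<open>a\<close> and its part over
    \<open>A\<close>, chosen independently.\<close>
  have bij: "bij_betw ?f (Pow (B a) \<times> Pow (Sigma A B)) (Pow (Sigma (insert a A) B))"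
    by (rule bij_betw_byWitness[where f' = "\<lambda>S. (S `` {a}, S - {a} \<times> UNIV)"])
      (use insert.hyps in auto)
  have weight: "w (insert a A) (?f (X, S)) = u X * w A S"
    if XS: "X \<subseteq> B a" "S \<subseteq> Sigma A B" for X S
  proof -
    have finX: "finite X"
      using XS insert.prems(1)[of a] by (auto intro: finite_subset)
    have finS: "finite S"
      using XS insert.prems(1) insert.hyps by (auto intro!: finite_subset[OF XS(2)])
    have a: "a \<notin> fst ` S" and sub: "fst ` S \<subseteq> A"
      using XS insert.hyps by auto
    \<comment> \<open>Rules out truncation: for empty \<open>X\<close> the exponent must grow by
      exactly 1 when \<open>card A\<close> becomes its successor.\<close>
    have "card (fst ` S) \<le> card A"
      using sub insert.hyps by (intro card_mono)
    moreover have "card ({a} \<times> X \<union> S) = card X + card S"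
      using finX finS a by (subst card_Un_disjoint) (force simp: card_cartesian_product)+
    moreover have "card (fst ` ({a} \<times> X \<union> S)) = (if X = {} then 0 else 1) + card (fst ` S)"
      using a finS by (simp add: image_Un)
    ultimately show ?thesis
      using insert.hyps by (auto simp: w_def u_def mult_monom power_add Suc_diff_le)
  qed
  have "(\<Sum>S\<in>Pow (Sigma (insert a A) B). w (insert a A) S)
      = (\<Sum>(X, S)\<in>Pow (B a) \<times> Pow (Sigma A B). u X * w A S)"
    unfolding sum.reindex_bij_betw[OF bij, symmetric]
    by (rule sum.cong) (auto simp: weight[simplified])
  also have "\<dots> = (\<Sum>X\<in>Pow (B a). u X) * (\<Sum>S\<in>Pow (Sigma A B). w A S)"
    by (simp add: sum_product sum.cartesian_product)
  also have "(\<Sum>X\<in>Pow (B a). u X) = [:-1, 1:]"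
    unfolding u_def using insert.prems by (intro sum_Pow_block) auto
  also have "(\<Sum>S\<in>Pow (Sigma A B). w A S) = [:-1, 1:] ^ card A"
    unfolding w_def using insert.prems by (intro insert.IH) auto
  finally show ?case
    using insert.hyps by (simp add: w_def)
qed

theorem corollary3p4:
  fixes n :: nat
  shows "chromatic_poly (transfer_matroid n) = [:-1, 1:] ^ n"
proof -
  have ground: "fst (transfer_matroid n) = edges n"
    by (simp add: transfer_matroid_def)
  \<comment> \<open>The block of each \<open>i < n\<close> contains the edge to \<open>n\<close>; no
    edge starts at \<open>n\<close>, so there are \<open>n\<close> blocks rather than
    \<open>n + 1\<close>.\<close>
  have "fst ` edges n = {..<n}"
    by (auto simp: edges_eq_Sigma image_iff)
  then have "rank (transfer_matroid n) (edges n) = n"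
    by (simp add: rank_transfer_matroid)
  then have "chromatic_poly (transfer_matroid n)
      = (\<Sum>S\<in>Pow (edges n). monom ((-1) ^ card S) (n - card (fst ` S)))"
    by (simp add: chromatic_poly_def ground rank_transfer_matroid cong: sum.cong_simp)
  also have "\<dots> = [:-1, 1:] ^ n"
    using sum_Pow_Sigma[of "{..<n}" "\<lambda>i. {i<..n}"] by (simp add: edges_eq_Sigma)
  finally show ?thesis .
qed

end
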